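(* Let $n\ge4$ and consider an edge $\gamma\gamma'$ with inner vertex $\gamma$ and boundary vertex $\gamma'$ in a mesh with $G^1$-smooth piecewise-cubic boundary equipped with the global in-plane parametrisation $\tilde\Pi^{(bicubic)}$. Let values be given for all "central" coefficients $C_0,\dots,C_n$ and for all non-middle "side" coefficients, i.e. $L_j,R_j$ with $j\in\{0,\dots,n\}\setminus\{2,\dots,n'-2\}$, such that Eq(0), Eq(1), Eq($n'+1$) are satisfied and, if $n\ge5$, also Eq($n'+2$) is satisfied. Consider the condition $(\ast)$ if $\deg(c)-\max\{\deg(l),\deg(r)\}=2$, then the C-equation $\sum_{i=0}^{n}(-1)^i\binom ni C_i=0$ holds. Then (1) $(\ast)$ is sufficient for the satisfaction of the sumC-equation; (2) $(\ast)$ is necessary and sufficient for the consistency of the "Middle" system, consisting of the equations Eq($s$), $s=2,\dots,n'$, and the sumC-equation (i.e. for its solvability in the side middle unknowns $L_2,\dots,L_{n'-2},R_2,\dots,R_{n'-2}$).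
   Context: $\langle a,b\rangle=a_Xb_Y-a_Yb_X$ for planar vectors. $n'=5$ if $n=4$ and $n'=n$ if $n\ge5$. Geometric setting: two adjacent boundary elements of a planar quadrilateral mesh share the straight edge from the inner vertex $\gamma$ to the boundary vertex $\gamma'$. The right element (relative to $\gamma\to\gamma'$) has vertices $\gamma,\rho,\rho',\gamma'$, the left one $\gamma,\lambda,\lambda',\gamma'$ (cyclic order), forming strictly convex quadrilaterals; the edges $\gamma'\rho'$ and $\gamma'\lambda'$ lie on the boundary of the domain and are cubic B\'ezier curves whose control points next to $\gamma'$ are $T_\rho$ and $T_\lambda$ respectively; the boundary is (non-degenerately) $G^1$-smooth at $\gamma'$, i.e. $\gamma'-T_\lambda$ and $T_\rho-\gamma'$ are nonzero, parallel and of the same direction. The in-plane parametrisation $\tilde\Pi^{(bicubic)}$ (assumed regular: bijective with nowhere vanishing Jacobian on each element) parametrises an element with inner vertices $A,B$ and boundary vertices $C,D$ (cyclic order $A,B,C,D$; $\tilde P(0,0)=A$, $\tilde P(1,0)=B$, $\tilde P(1,1)=C$, $\tilde P(0,1)=D$) and boundary curve control points $D,E,F,C$ by $\tilde P=\sum_{i,j=0}^3\tilde P_{ij}B^3_i(u)B^3_j(v)$, where rows $j=0,1$ and the points $\tilde P_{02},\tilde P_{32}$ come from degree elevation of the bilinear map with corners $A,B,C,D$, $\tilde P_{12}=\frac19(2A+B+C+2D+3E)$, $\tilde P_{22}=\frac19(A+2B+2C+D+3F)$, and $\tilde P_{03},\tilde P_{13},\tilde P_{23},\tilde P_{33}=D,E,F,C$.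 With the left patch having the common edge at $u=1$ and the right one at $u=0$ ($v=0$ at $\gamma$), this gives along the edge: $v$-derivative $\gamma'-\gamma$; $u$-derivative of the left patch $\sum_{i=0}^2a_iB^2_i(v)$ with $a_0=\gamma-\lambda$, $a_1=\frac12[(\gamma-\lambda)+(\gamma'-\lambda')]$, $a_2=3(\gamma'-T_\lambda)$; $u$-derivative of the right patch $\sum_{i=0}^2b_iB^2_i(v)$ with $b_0=\rho-\gamma$, $b_1=\frac12[(\rho-\gamma)+(\rho'-\gamma')]$, $b_2=3(T_\rho-\gamma')$. Weight functions: $l(v)=\sum_{i=0}^2l_iB^2_i(v)$, $r(v)=\sum_{i=0}^2r_iB_i^2(v)$, $c(v)=\sum_{k=0}^4c_kB^4_k(v)$ with $l_i=\langle b_i,\gamma'-\gamma\rangle$, $r_i=-\langle a_i,\gamma'-\gamma\rangle$, $c_k=\binom4k^{-1}\sum_{i+j=k,\,0\le i,j\le2}\binom2i\binom2j\langle a_i,b_j\rangle$. $\deg$ denotes the actual polynomial degree (degree $0$ for the zero polynomial). $Z$ is a degree-$n$ tensor-product B\'ezier polynomial on each element; $C_0,\dots,C_n$ are its coefficients along the edge from $\gamma$ to $\gamma'$; $L_j$, $R_j$ ($0\le j\le n$) those of the neighbouring rows in the left/right element; $\Delta L_j=C_j-L_j$, $\Delta R_j=R_j-C_j$, $\Delta C_j=C_{j+1}-C_j$. Put $$\mathrm{sumLR}_s=\sum_{\substack{i+j=s\\0\le i\le n,\,0\le j\le2}}\binom ni\binom2j(l_j\Delta L_i+r_j\Delta R_i),\qquad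 \mathrm{sumC}_s=\sum_{\substack{i+j=s\\0\le i\le n-1,\,0\le j\le4}}\binom{n-1}i\binom4jc_j\Delta C_i .$$ Eq($s$), $s=0,\dots,n+2$: $\mathrm{sumLR}_s=(-1)^{s+1}\sum_{k=0}^s(-1)^k\mathrm{sumC}_k$. sumC-equation: $\sum_{k=0}^{n+3}(-1)^k\mathrm{sumC}_k=0$. (Together these equations express $G^1$-continuity across the edge.) The middle coefficients are $L_2,\dots,L_{n'-2}$, $R_2,\dots,R_{n'-2}$ (side) and $C_3,\dots,C_{n'-2}$ (central). *)

theory Defs
  imports "HOL-Analysis.Analysis" "HOL-Computational_Algebra.Polynomial"
begin

definition planar_cross :: "real ^ 2 \<Rightarrow> real ^ 2 \<Rightarrow> real" where
  "planar_cross a b = a $ 1 * b $ 2 - a $ 2 * b $ 1"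

definition left_of :: "real ^ 2 \<Rightarrow> real ^ 2 \<Rightarrow> real ^ 2 \<Rightarrow> bool" where
  "left_of p q x \<longleftrightarrow> planar_cross (q - p) (x - p) > 0"

definition right_of :: "real ^ 2 \<Rightarrow> real ^ 2 \<Rightarrow> real ^ 2 \<Rightarrow> bool" where
  "right_of p q x \<longleftrightarrow> planar_cross (q - p) (x - p) < 0"

text \<open>Vertices are listed in cyclic order, in either orientation.  Strict convexity means that
  the boundary turns strictly to the same side at all four vertices.\<close>

definition strictly_convex_quad :: "real ^ 2 \<Rightarrow> real ^ 2 \<Rightarrow> real ^ 2 \<Rightarrow> real ^ 2 \<Rightarrow> bool" where
  "strictly_convex_quad A B C D \<longleftrightarrow>
     (left_of A B C \<and> left_of B C D \<and> left_of C D A \<and> left_of D A B) \<or>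
     (right_of A B C \<and> right_of B C D \<and> right_of C D A \<and> right_of D A B)"

definition cubic_bezier :: "real ^ 2 \<Rightarrow> real ^ 2 \<Rightarrow> real ^ 2 \<Rightarrow> real ^ 2 \<Rightarrow> real \<Rightarrow> real ^ 2" where
  "cubic_bezier P0 P1 P2 P3 t =
     Bernstein 3 0 t *\<^sub>R P0 + Bernstein 3 1 t *\<^sub>R P1 + Bernstein 3 2 t *\<^sub>R P2 + Bernstein 3 3 t *\<^sub>R P3"

text \<open>A boundary element has the inner vertices \<open>A, B\<close>, the boundary vertices \<open>C, D\<close>
  (cyclic order \<open>A, B, C, D\<close>), three straight edges, and a cubic boundary edge with control
  points \<open>D, E, F, C\<close>.\<close>

definition element_frontier ::
  "real ^ 2 \<Rightarrow> real ^ 2 \<Rightarrow> real ^ 2 \<Rightarrow> real ^ 2 \<Rightarrow> real ^ 2 \<Rightarrow> real ^ 2 \<Rightarrow> (real ^ 2) set" where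
  "element_frontier A B C D E F =
     closed_segment A B \<union> closed_segment B C \<union> closed_segment D A \<union> cubic_bezier D E F C ` {0..1}"

definition boundary_element ::
  "real ^ 2 \<Rightarrow> real ^ 2 \<Rightarrow> real ^ 2 \<Rightarrow> real ^ 2 \<Rightarrow> real ^ 2 \<Rightarrow> real ^ 2 \<Rightarrow> (real ^ 2) set" where
  "boundary_element A B C D E F =
     element_frontier A B C D E F \<union> inside (element_frontier A B C D E F)"

text \<open>Control points of the bilinear map \<open>(u, v) \<mapsto> (1-u)(1-v) A + u(1-v) B + u v C + (1-u) v D\<close>
  after degree elevation to bidegree \<open>(3, 3)\<close>.\<close>

definition elevated_bilinear_control ::
  "real ^ 2 \<Rightarrow> real ^ 2 \<Rightarrow> real ^ 2 \<Rightarrow> real ^ 2 \<Rightarrow> nat \<Rightarrow> nat \<Rightarrow> real ^ 2" where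
  "elevated_bilinear_control A B C D i j =
     (1/9) *\<^sub>R (((3 - real i) * (3 - real j)) *\<^sub>R A + (real i * (3 - real j)) *\<^sub>R B
              + (real i * real j) *\<^sub>R C + ((3 - real i) * real j) *\<^sub>R D)"

definition bicubic_control ::
  "real ^ 2 \<Rightarrow> real ^ 2 \<Rightarrow> real ^ 2 \<Rightarrow> real ^ 2 \<Rightarrow> real ^ 2 \<Rightarrow> real ^ 2 \<Rightarrow> nat \<Rightarrow> nat \<Rightarrow> real ^ 2" where
  "bicubic_control A B C D E F i j =
     (if j = 3 then [D, E, F, C] ! i
      else if i = 1 \<and> j = 2 then (1/9) *\<^sub>R (2 *\<^sub>R A + B + C + 2 *\<^sub>R D + 3 *\<^sub>R E)
      else if i = 2 \<and> j = 2 then (1/9) *\<^sub>R (A + 2 *\<^sub>R B + 2 *\<^sub>R C + D + 3 *\<^sub>R F)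
      else elevated_bilinear_control A B C D i j)"

definition bicubic_patch ::
  "real ^ 2 \<Rightarrow> real ^ 2 \<Rightarrow> real ^ 2 \<Rightarrow> real ^ 2 \<Rightarrow> real ^ 2 \<Rightarrow> real ^ 2 \<Rightarrow> real \<Rightarrow> real \<Rightarrow> real ^ 2" where
  "bicubic_patch A B C D E F u v =
     (\<Sum>i=0..3. \<Sum>j=0..3. (Bernstein 3 i u * Bernstein 3 j v) *\<^sub>R bicubic_control A B C D E F i j)"

definition jacobian :: "(real \<Rightarrow> real \<Rightarrow> real ^ 2) \<Rightarrow> real \<Rightarrow> real \<Rightarrow> real" where
  "jacobian P u v =
     planar_cross (vector_derivative (\<lambda>s. P s v) (at u)) (vector_derivative (\<lambda>t. P u t) (at v))"

definition regular_bicubic_patch ::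
  "real ^ 2 \<Rightarrow> real ^ 2 \<Rightarrow> real ^ 2 \<Rightarrow> real ^ 2 \<Rightarrow> real ^ 2 \<Rightarrow> real ^ 2 \<Rightarrow> bool" where
  "regular_bicubic_patch A B C D E F \<longleftrightarrow>
     bij_betw (\<lambda>(u, v). bicubic_patch A B C D E F u v) ({0..1} \<times> {0..1})
       (boundary_element A B C D E F) \<and>
     (\<forall>u\<in>{0..1}. \<forall>v\<in>{0..1}. jacobian (bicubic_patch A B C D E F) u v \<noteq> 0)"

text \<open>Quadratic B\'ezier coefficients of the \<open>u\<close>-derivatives of the left and right patch along
  the common edge; see the lemmas \<open>left_patch_u_derivative\<close> and
  \<open>right_patch_u_derivative\<close> below.\<close>

definition left_deriv_coeff ::
  "real ^ 2 \<Rightarrow> real ^ 2 \<Rightarrow> real ^ 2 \<Rightarrow> real ^ 2 \<Rightarrow> real ^ 2 \<Rightarrow> nat \<Rightarrow> real ^ 2" where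
  "left_deriv_coeff \<gamma> \<gamma>' lam lam' T i =
     (if i = 0 then \<gamma> - lam
      else if i = 1 then (1/2) *\<^sub>R ((\<gamma> - lam) + (\<gamma>' - lam'))
      else 3 *\<^sub>R (\<gamma>' - T))"

definition right_deriv_coeff ::
  "real ^ 2 \<Rightarrow> real ^ 2 \<Rightarrow> real ^ 2 \<Rightarrow> real ^ 2 \<Rightarrow> real ^ 2 \<Rightarrow> nat \<Rightarrow> real ^ 2" where
  "right_deriv_coeff \<gamma> \<gamma>' \<rho> \<rho>' T i =
     (if i = 0 then \<rho> - \<gamma>
      else if i = 1 then (1/2) *\<^sub>R ((\<rho> - \<gamma>) + (\<rho>' - \<gamma>'))
      else 3 *\<^sub>R (T - \<gamma>'))"

text \<open>Here \<open>a\<close>, \<open>b\<close> are the derivative coefficients of the left and right patch and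
  \<open>e = \<gamma>' - \<gamma>\<close> is the \<open>v\<close>-derivative along the edge.  Note that the weight \<open>l\<close> of the left
  rows comes from the right patch and vice versa; \<open>c\<close> holds the quartic B\'ezier coefficients
  of the cross product of the two \<open>u\<close>-derivatives.\<close>

definition weight_l_coeff :: "(nat \<Rightarrow> real ^ 2) \<Rightarrow> real ^ 2 \<Rightarrow> nat \<Rightarrow> real" where
  "weight_l_coeff b e i = planar_cross (b i) e"

definition weight_r_coeff :: "(nat \<Rightarrow> real ^ 2) \<Rightarrow> real ^ 2 \<Rightarrow> nat \<Rightarrow> real" where
  "weight_r_coeff a e i = - planar_cross (a i) e"

definition weight_c_coeff :: "(nat \<Rightarrow> real ^ 2) \<Rightarrow> (nat \<Rightarrow> real ^ 2) \<Rightarrow> nat \<Rightarrow> real" where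
  "weight_c_coeff a b k =
     (\<Sum>(i, j)\<in>{(i, j). i \<in> {0..2} \<and> j \<in> {0..2} \<and> i + j = k}.
        real (2 choose i) * real (2 choose j) * planar_cross (a i) (b j)) / real (4 choose k)"

definition bernstein_poly :: "nat \<Rightarrow> nat \<Rightarrow> real poly" where
  "bernstein_poly n k = smult (real (n choose k)) ([:0, 1:] ^ k * [:1, -1:] ^ (n - k))"

definition bezier_poly :: "nat \<Rightarrow> (nat \<Rightarrow> real) \<Rightarrow> real poly" where
  "bezier_poly n p = (\<Sum>k=0..n. smult (p k) (bernstein_poly n k))"

definition sumLR ::
  "nat \<Rightarrow> (nat \<Rightarrow> real) \<Rightarrow> (nat \<Rightarrow> real) \<Rightarrow> (nat \<Rightarrow> real) \<Rightarrow> (nat \<Rightarrow> real) \<Rightarrow> (nat \<Rightarrow> real) \<Rightarrow> nat \<Rightarrow> real"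
  where
  "sumLR n l r C L R s =
     (\<Sum>(i, j)\<in>{(i, j). i \<in> {0..n} \<and> j \<in> {0..2} \<and> i + j = s}.
        real (n choose i) * real (2 choose j) * (l j * (C i - L i) + r j * (R i - C i)))"

definition sumC :: "nat \<Rightarrow> (nat \<Rightarrow> real) \<Rightarrow> (nat \<Rightarrow> real) \<Rightarrow> nat \<Rightarrow> real" where
  "sumC n c C s =
     (\<Sum>(i, j)\<in>{(i, j). i \<in> {0..n - 1} \<and> j \<in> {0..4} \<and> i + j = s}.
        real ((n - 1) choose i) * real (4 choose j) * c j * (C (i + 1) - C i))"

text \<open>Comparison of the coefficients in \<open>l L\<^sub>u + r R\<^sub>u + c Z\<^sub>v = 0\<close>, where the degree
  \<open>n + 2\<close> part has been degree-elevated to \<open>n + 3\<close> and the resulting recursion solved.\<close>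

definition Eq_s ::
  "nat \<Rightarrow> (nat \<Rightarrow> real) \<Rightarrow> (nat \<Rightarrow> real) \<Rightarrow> (nat \<Rightarrow> real) \<Rightarrow>
   (nat \<Rightarrow> real) \<Rightarrow> (nat \<Rightarrow> real) \<Rightarrow> (nat \<Rightarrow> real) \<Rightarrow> nat \<Rightarrow> bool" where
  "Eq_s n l r c C L R s \<longleftrightarrow>
     sumLR n l r C L R s = (-1) ^ (s + 1) * (\<Sum>k=0..s. (-1) ^ k * sumC n c C k)"

definition sumC_equation :: "nat \<Rightarrow> (nat \<Rightarrow> real) \<Rightarrow> (nat \<Rightarrow> real) \<Rightarrow> bool" where
  "sumC_equation n c C \<longleftrightarrow> (\<Sum>k=0..n + 3. (-1) ^ k * sumC n c C k) = 0"

definition C_equation :: "nat \<Rightarrow> (nat \<Rightarrow> real) \<Rightarrow> bool" where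
  "C_equation n C \<longleftrightarrow> (\<Sum>i=0..n. (-1) ^ i * real (n choose i) * C i) = 0"

definition nprime :: "nat \<Rightarrow> nat" where
  "nprime n = (if n = 4 then 5 else n)"

text \<open>The difference of degrees is taken in the integers, as it may be negative.\<close>

definition degree_condition ::
  "nat \<Rightarrow> (nat \<Rightarrow> real) \<Rightarrow> (nat \<Rightarrow> real) \<Rightarrow> (nat \<Rightarrow> real) \<Rightarrow> (nat \<Rightarrow> real) \<Rightarrow> bool" where
  "degree_condition n l r c C \<longleftrightarrow>
     (int (degree (bezier_poly 4 c))
        - int (max (degree (bezier_poly 2 l)) (degree (bezier_poly 2 r))) = 2
      \<longrightarrow> C_equation n C)"

text \<open>Solvability in the side middle unknowns: the non-middle side coefficients of the solution are
  prescribed by \<open>L0, R0\<close>, whose values at middle indices play no role.\<close>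

definition middle_system_consistent ::
  "nat \<Rightarrow> (nat \<Rightarrow> real) \<Rightarrow> (nat \<Rightarrow> real) \<Rightarrow> (nat \<Rightarrow> real) \<Rightarrow>
   (nat \<Rightarrow> real) \<Rightarrow> (nat \<Rightarrow> real) \<Rightarrow> (nat \<Rightarrow> real) \<Rightarrow> bool" where
  "middle_system_consistent n l r c C L0 R0 \<longleftrightarrow>
     (\<exists>L R. (\<forall>j \<in> {0..n} - {2..nprime n - 2}. L j = L0 j \<and> R j = R0 j) \<and>
            (\<forall>s \<in> {2..nprime n}. Eq_s n l r c C L R s) \<and>
            sumC_equation n c C)"

lemma poly_bernstein_poly: "poly (bernstein_poly n k) x = Bernstein n k x"
  by (simp add: bernstein_poly_def Bernstein_def)

lemma bernstein3_derivative_0: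
  assumes "i \<le> 3"
  shows "(Bernstein 3 i has_real_derivative (if i = 0 then -3 else if i = 1 then 3 else 0)) (at 0)"
proof -
  from assms consider "i = 0" | "i = 1" | "i = 2" | "i = 3" by linarith
  then show ?thesis
    by cases (auto simp: Bernstein_def[abs_def] numeral_eq_Suc intro!: derivative_eq_intros)
qed

lemma bernstein3_derivative_1:
  assumes "i \<le> 3"
  shows "(Bernstein 3 i has_real_derivative (if i = 2 then -3 else if i = 3 then 3 else 0)) (at 1)"
proof -
  from assms consider "i = 0" | "i = 1" | "i = 2" | "i = 3" by linarith
  then show ?thesis
    by cases (auto simp: Bernstein_def[abs_def] numeral_eq_Suc intro!: derivative_eq_intros)
qed

lemma bicubic_patch_u_derivative:
  assumes "\<And>i. i \<le> 3 \<Longrightarrow> (Bernstein 3 i has_real_derivative d i) (at u)"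
  shows "((\<lambda>s. bicubic_patch A B C D E F s v) has_vector_derivative
     (\<Sum>i=0..3. \<Sum>j=0..3. (d i * Bernstein 3 j v) *\<^sub>R bicubic_control A B C D E F i j)) (at u)"
proof -
  have "((\<lambda>s. (Bernstein 3 i s * Bernstein 3 j v) *\<^sub>R K) has_vector_derivative
     (d i * Bernstein 3 j v) *\<^sub>R K) (at u)" if "i \<le> 3" for i j and K :: "real ^ 2"
    using has_vector_derivative_scaleR[OF DERIV_cmult_right[OF assms[OF that]] has_vector_derivative_const]
    by simp
  then show ?thesis
    unfolding bicubic_patch_def by (intro has_vector_derivative_sum) auto
qed

lemma right_patch_u_derivative:
  "((\<lambda>s. bicubic_patch \<gamma> \<rho> \<rho>' \<gamma>' T S s v) has_vector_derivative
     (\<Sum>i=0..2. Bernstein 2 i v *\<^sub>R right_deriv_coeff \<gamma> \<gamma>' \<rho> \<rho>' T i)) (at 0)"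
  by (rule has_vector_derivative_eq_rhs[OF bicubic_patch_u_derivative[OF bernstein3_derivative_0]])
    (simp_all add: vec_eq_iff bicubic_control_def elevated_bilinear_control_def
      right_deriv_coeff_def Bernstein_def numeral_eq_Suc, algebra?)

lemma left_patch_u_derivative:
  "((\<lambda>s. bicubic_patch lam \<gamma> \<gamma>' lam' S T s v) has_vector_derivative
     (\<Sum>i=0..2. Bernstein 2 i v *\<^sub>R left_deriv_coeff \<gamma> \<gamma>' lam lam' T i)) (at 1)"
  by (rule has_vector_derivative_eq_rhs[OF bicubic_patch_u_derivative[OF bernstein3_derivative_1]])
    (simp_all add: vec_eq_iff bicubic_control_def elevated_bilinear_control_def
      left_deriv_coeff_def Bernstein_def numeral_eq_Suc, algebra?)

lemma patch_common_edge:
  "bicubic_patch \<gamma> \<rho> \<rho>' \<gamma>' T S 0 v = (1 - v) *\<^sub>R \<gamma> + v *\<^sub>R \<gamma>'"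
  "bicubic_patch lam \<gamma> \<gamma>' lam' S T 1 v = (1 - v) *\<^sub>R \<gamma> + v *\<^sub>R \<gamma>'"
  apply (simp_all add: vec_eq_iff bicubic_patch_def bicubic_control_def elevated_bilinear_control_def
      Bernstein_def numeral_eq_Suc)
  apply algebra+
  done

end

theory Submission
  imports Defs
    "HOL-Computational_Algebra.Field_as_Ring"
    "HOL-Computational_Algebra.Polynomial_Factorial"
begin

text \<open>
  Substituting \<open>t = v / (1 - v)\<close> and clearing powers of \<open>1 - v\<close> turns a B\'ezier polynomial of
  formal degree \<open>n\<close> with coefficients \<open>p\<^sub>k\<close> into the scaled polynomial
  \<open>\<Sum>\<^sub>k (n choose k) p\<^sub>k t\<^sup>k\<close>.  Write \<open>l\<close>, \<open>r\<close>, \<open>c\<close>, \<open>X\<close>, \<open>Y\<close>, \<open>D\<close> for the scaled polynomials of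
  the three weights and of \<open>\<Delta>L\<close>, \<open>\<Delta>R\<close>, \<open>\<Delta>C\<close>.  Then all equations Eq(\<open>s\<close>) together
  with the sumC-equation say exactly \<open>(1 + t) (l X + r Y) = - c D\<close> (\<open>G1_system_iff\<close>).  The point
  \<open>t = -1\<close> corresponds to \<open>v = \<infinity>\<close>: the order of vanishing there is the amount by which the actual
  degree drops below the formal one (\<open>degree_bezier_poly\<close>), and the C-equation says
  \<open>D(-1) = 0\<close>.

  Let \<open>g = gcd l r\<close>.  Since \<open>l\<close> and \<open>r\<close> are the components of the two \<open>u\<close>-derivatives normal to
  the edge, and \<open>c\<close> is the cross product of these derivatives, \<open>c\<close> lies in the ideal of
  \<open>l\<close> and \<open>r\<close>, so \<open>c = g w\<close> (\<open>gcd_weights_dvd_weight_c\<close>).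
  Comparing orders at \<open>-1\<close>, the degree difference is \<open>2\<close> minus the order of \<open>w\<close> if \<open>w \<noteq> 0\<close>,
  while for \<open>w = 0\<close> it is not positive; so the premise of the condition is \<open>w(-1) \<noteq> 0\<close>, and
  the whole condition is \<open>w(-1) D(-1) = 0\<close>, that is, \<open>(1 + t) g\<close> divides \<open>c D\<close>.  The sumC-equation is \<open>c(-1) D(-1) = 0\<close>, which follows.

  The same divisibility characterises consistency (\<open>middle_system_consistent_iff_dvd\<close>).  It is
  necessary, because \<open>g\<close> divides \<open>l X + r Y\<close>.  For the converse, changing the middle side
  coefficients changes \<open>X\<close> and \<open>Y\<close> by \<open>t\<^sup>2 x\<close> and \<open>t\<^sup>2 y\<close> with \<open>x\<close>, \<open>y\<close> of degree at most
  \<open>m = n' - 4\<close>, and the prescribed equations leave a defect \<open>t\<^sup>2 q\<close> with \<open>q\<close> of degree at most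
  \<open>m + 2\<close>.  The vertex \<open>\<rho>\<close> is off the line of the edge, which gives \<open>l(0) \<noteq> 0\<close>, so \<open>g\<close>
  divides \<open>q\<close>; regularity of the right patch at the boundary vertex makes \<open>l\<close> exactly quadratic, and \<open>m \<ge> 1\<close>; hence \<open>l x + r y = q\<close> has a solution
  within the degree bounds (\<open>bounded_bezout\<close>).
\<close>

section \<open>Scaled B\'ezier polynomials\<close>

definition scaled_poly :: "nat \<Rightarrow> (nat \<Rightarrow> real) \<Rightarrow> real poly" where
  "scaled_poly n p = (\<Sum>k\<le>n. monom (real (n choose k) * p k) k)"

lemma coeff_scaled_poly [simp]: "coeff (scaled_poly n p) k = real (n choose k) * p k"
  by (simp add: scaled_poly_def coeff_sum sum.delta binomial_eq_0)

lemma degree_scaled_poly_le: "degree (scaled_poly n p) \<le> n"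
  by (rule degree_le) (simp add: binomial_eq_0)

text \<open>Every polynomial of degree at most \<open>n\<close> is a scaled polynomial; this form turns a solution
  found among polynomials back into B\'ezier coefficients.\<close>
lemma scaled_poly_add:
  assumes "degree q \<le> n"
  shows "scaled_poly n (\<lambda>i. p i + coeff q i / real (n choose i)) = scaled_poly n p + q"
proof (rule poly_eqI)
  show "coeff (scaled_poly n (\<lambda>i. p i + coeff q i / real (n choose i))) i
      = coeff (scaled_poly n p + q) i" for i
    using assms by (cases "i \<le> n") (simp_all add: distrib_left binomial_eq_0 coeff_eq_0)
qed

lemma coeff_mult_scaled_poly:
  "coeff (scaled_poly n p * scaled_poly m q) s =
     (\<Sum>(i, j)\<in>{(i, j). i \<in> {0..n} \<and> j \<in> {0..m} \<and> i + j = s}.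
        real (n choose i) * real (m choose j) * (p i * q j))"
proof -
  let ?f = "\<lambda>i. real (n choose i) * real (m choose (s - i)) * (p i * q (s - i))"
  let ?I = "{i. i \<le> s \<and> i \<le> n \<and> s - i \<le> m}"
  have "coeff (scaled_poly n p * scaled_poly m q) s = (\<Sum>i\<le>s. ?f i)"
    unfolding coeff_mult by (intro sum.cong) simp_all
  also have "\<dots> = (\<Sum>i\<in>?I. ?f i)"
    by (rule sum.mono_neutral_right) (auto simp: binomial_eq_0)
  also have "\<dots> = (\<Sum>(i, j)\<in>{(i, j). i \<in> {0..n} \<and> j \<in> {0..m} \<and> i + j = s}.
        real (n choose i) * real (m choose j) * (p i * q j))"
    by (rule sum.reindex_bij_witness[of _ fst "\<lambda>i. (i, s - i)"]) auto
  finally show ?thesis .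
qed

lemma poly_eq_sum_le:
  fixes p :: "'a::comm_semiring_1 poly"
  assumes "degree p \<le> n"
  shows "poly p x = (\<Sum>i\<le>n. coeff p i * x ^ i)"
  unfolding poly_altdef using assms
  by (intro sum.mono_neutral_left) (auto simp: coeff_eq_0)

lemma poly_scaled_poly: "poly (scaled_poly n p) x = (\<Sum>k\<le>n. real (n choose k) * p k * x ^ k)"
  by (simp add: poly_eq_sum_le[OF degree_scaled_poly_le])

text \<open>The \<open>n\<close>-th difference of \<open>C\<close> is the \<open>(n - 1)\<close>-th difference of \<open>\<Delta>C\<close>.\<close>
lemma C_equation_iff_root:
  assumes "n \<ge> 1"
  shows "C_equation n C \<longleftrightarrow> poly (scaled_poly (n - 1) (\<lambda>i. C (i + 1) - C i)) (-1) = 0"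
proof -
  obtain m where n: "n = Suc m" using assms by (cases n) auto
  let ?t = "\<lambda>i. (-1) ^ i * real (m choose i) * C i"
  have "(\<Sum>i\<le>Suc m. (-1) ^ i * real (Suc m choose i) * C i)
      = C 0 + (\<Sum>i\<le>m. (-1) ^ Suc i * real (Suc m choose Suc i) * C (Suc i))"
    by (subst sum.atMost_Suc_shift) simp
  also have "\<dots> = (C 0 + (\<Sum>i\<le>m. ?t (Suc i))) - (\<Sum>i\<le>m. (-1) ^ i * real (m choose i) * C (Suc i))"
    by (simp add: distrib_left left_diff_distrib sum_subtractf sum.distrib sum_negf)
  also have "C 0 + (\<Sum>i\<le>m. ?t (Suc i)) = (\<Sum>i\<le>Suc m. ?t i)"
    by (subst sum.atMost_Suc_shift) simp
  also have "(\<Sum>i\<le>Suc m. ?t i) = (\<Sum>i\<le>m. ?t i)"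
    by (simp add: binomial_eq_0)
  also have "\<dots> - (\<Sum>i\<le>m. (-1) ^ i * real (m choose i) * C (Suc i))
      = - poly (scaled_poly m (\<lambda>i. C (i + 1) - C i)) (-1)"
    by (simp add: poly_scaled_poly algebra_simps sum_subtractf sum.distrib)
  finally show ?thesis
    by (simp add: C_equation_def n atMost_atLeast0)
qed

section \<open>Actual degree and order at minus one\<close>

text \<open>This is \<open>(1 - v)\<^sup>n p(v / (1 - v))\<close> with the denominators cleared.\<close>
definition homogenization :: "nat \<Rightarrow> 'a::comm_ring_1 poly \<Rightarrow> 'a poly" where
  "homogenization n p = (\<Sum>i\<le>n. smult (coeff p i) ([:0, 1:] ^ i * [:1, -1:] ^ (n - i)))"

lemma bezier_poly_eq_homogenization: "bezier_poly n p = homogenization n (scaled_poly n p)"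
  by (simp add: bezier_poly_def bernstein_poly_def homogenization_def atMost_atLeast0 mult.commute)

text \<open>Under \<open>t = v / (1 - v)\<close> the factor \<open>1 + t\<close> becomes \<open>1 / (1 - v)\<close>, so it only lowers the
  formal degree.\<close>
lemma homogenization_one_plus_mult:
  fixes p :: "'a::comm_ring_1 poly"
  assumes "degree p \<le> n"
  shows "homogenization (Suc n) ([:1, 1:] * p) = homogenization n p"
proof -
  let ?w = "\<lambda>i. [:0, 1:] ^ i * [:1, -1:] ^ (n - i) :: 'a poly"
  let ?v = "\<lambda>i. [:0, 1:] ^ i * [:1, -1:] ^ (Suc n - i) :: 'a poly"
  have top: "coeff p (Suc n) = 0" using assms by (simp add: coeff_eq_0)
  have one: "[:1, -1:] + [:0, 1:] = (1 :: 'a poly)" by (simp add: one_pCons)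
  have "homogenization (Suc n) ([:1, 1:] * p)
      = (\<Sum>i\<le>Suc n. smult (coeff p i) (?v i)) + (\<Sum>i\<le>Suc n. smult (coeff (pCons 0 p) i) (?v i))"
    by (simp add: homogenization_def smult_add_left sum.distrib del: sum.atMost_Suc)
  also have "(\<Sum>i\<le>Suc n. smult (coeff p i) (?v i)) = (\<Sum>i\<le>n. smult (coeff p i) (?w i * [:1, -1:]))"
    by (auto simp: top Suc_diff_le power_Suc2 mult.assoc simp del: power_Suc mult_pCons_right intro!: sum.cong)
  also have "(\<Sum>i\<le>Suc n. smult (coeff (pCons 0 p) i) (?v i)) = (\<Sum>i\<le>n. smult (coeff p i) (?w i * [:0, 1:]))"
    by (subst sum.atMost_Suc_shift)
      (auto simp: power_Suc mult.assoc mult.commute[of "[:0, 1:]"] simp del: mult_pCons_right mult_pCons_left intro!: sum.cong)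
  also have "(\<Sum>i\<le>n. smult (coeff p i) (?w i * [:1, -1:])) + (\<Sum>i\<le>n. smult (coeff p i) (?w i * [:0, 1:]))
      = (\<Sum>i\<le>n. smult (coeff p i) (?w i * ([:1, -1:] + [:0, 1:])))"
    by (simp only: distrib_left smult_add_right sum.distrib)
  finally show ?thesis
    by (simp only: one mult_1_right homogenization_def)
qed

text \<open>Each summand has degree \<open>n\<close>, and their leading coefficients add up to \<open>p(-1)\<close> up to sign.\<close>
lemma degree_homogenization:
  fixes p :: "'a::idom poly"
  assumes "degree p \<le> n" "poly p (-1) \<noteq> 0"
  shows "degree (homogenization n p) = n"
proof (rule antisym)
  let ?w = "\<lambda>i. [:0, 1:] ^ i * [:1, -1:] ^ (n - i) :: 'a poly"
  have deg: "degree (?w i) = n" if "i \<le> n" for i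
    using that by (simp add: degree_mult_eq degree_power_eq)
  have "coeff (?w i) n = (-1) ^ (n - i)" if "i \<le> n" for i
    using lead_coeff_mult[of "[:0, 1:] ^ i" "[:1, -1:] ^ (n - i) :: 'a poly"] deg[OF that]
    by (simp add: lead_coeff_power)
  then have "coeff (homogenization n p) n = (\<Sum>i\<le>n. coeff p i * (-1) ^ (n - i))"
    by (simp add: homogenization_def coeff_sum)
  also have "\<dots> = (-1) ^ n * poly p (-1)"
    by (simp add: poly_eq_sum_le[OF assms(1)] sum_distrib_left)
      (intro sum.cong; simp add: minus_one_power_iff)
  finally show "n \<le> degree (homogenization n p)"
    using assms(2) by (intro le_degree) simp
  show "degree (homogenization n p) \<le> n"
    unfolding homogenization_def by (intro degree_sum_le) (auto intro: order_trans[OF degree_smult_le] simp: deg)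
qed

text \<open>Strip all factors \<open>1 + t\<close> from the scaled polynomial: each one lowers the formal degree by
  one without changing the B\'ezier polynomial, and the cofactor does not vanish at \<open>-1\<close>, so the
  formal degree reached is the actual one.\<close>
lemma degree_bezier_poly:
  assumes "scaled_poly n p \<noteq> 0"
  shows "degree (bezier_poly n p) + order (-1) (scaled_poly n p) = n"
proof -
  define k where "k = order (-1) (scaled_poly n p)"
  obtain h where h: "scaled_poly n p = [:1, 1:] ^ k * h" "\<not> [:1, 1:] dvd h"
    using order_decomp[OF assms, of "-1"] by (auto simp: k_def)
  have nz: "poly h (-1) \<noteq> 0" using h(2) by (simp add: poly_eq_0_iff_dvd)
  then have "h \<noteq> 0" by auto
  then have deg: "degree (scaled_poly n p) = k + degree h"
    by (simp add: h(1) degree_mult_eq degree_power_eq)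
  then have kn: "k + degree h \<le> n" using degree_scaled_poly_le[of n p] by simp
  have "homogenization (j + m) ([:1, 1:] ^ j * h) = homogenization m h" if "degree h \<le> m" for j m
  proof (induction j)
    case (Suc j)
    have "degree ([:1, 1:] ^ j * h) \<le> j + m"
      using that \<open>h \<noteq> 0\<close> by (simp add: degree_mult_eq degree_power_eq)
    then show ?case
      using homogenization_one_plus_mult[of "[:1, 1:] ^ j * h" "j + m"] Suc
      by (simp add: mult.assoc del: mult_pCons_left)
  qed simp
  from this[of "n - k" k] kn have "bezier_poly n p = homogenization (n - k) h"
    by (simp add: bezier_poly_eq_homogenization h(1))
  with kn nz show ?thesis
    by (simp add: degree_homogenization flip: k_def)
qed

section \<open>Bezout equations with degree bounds\<close>

text \<open>Reducing the coefficient of \<open>r\<close> in any solution modulo \<open>l / gcd l r\<close> brings it below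
  the degree of \<open>l\<close>; the bound on the other coefficient is then forced by the degree of \<open>l x\<close>.\<close>
lemma bounded_bezout:
  fixes l r q :: "'a::field_gcd poly"
  assumes "l \<noteq> 0" and r: "degree r \<le> degree l" and m: "degree l \<le> m + 1"
    and q: "degree q \<le> m + degree l" and dvd: "gcd l r dvd q"
  obtains x y where "degree x \<le> m" "degree y \<le> m" "l * x + r * y = q"
proof -
  obtain u w where uw: "u * l + w * r = gcd l r"
    using bezout_coefficients_fst_snd by blast
  obtain q' where q': "q = gcd l r * q'" using dvd by blast
  obtain l' where l': "l = gcd l r * l'" by (meson gcd_dvd1 dvdE)
  obtain r' where r': "r = gcd l r * r'" by (meson gcd_dvd2 dvdE)
  have nz: "l' \<noteq> 0" "gcd l r \<noteq> 0" using \<open>l \<noteq> 0\<close> l' by auto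
  define y where "y = (w * q') mod l'"
  define x where "x = u * q' + r' * ((w * q') div l')"
  have cross: "l * r' = r * l'" by (metis l' r' mult.assoc mult.commute)
  have "l * x + r * y = u * q' * l + (l * r') * ((w * q') div l') + r * y"
    by (simp add: x_def distrib_left mult_ac)
  also have "\<dots> = u * q' * l + r * (l' * ((w * q') div l') + y)"
    by (simp only: cross distrib_left mult.assoc add.assoc)
  also have "\<dots> = (u * l + w * r) * q'"
    by (simp add: y_def algebra_simps)
  finally have eq: "l * x + r * y = q" using uw q' by metis
  have "degree l' \<le> degree l"
    using dvd_imp_degree_le[OF _ \<open>l \<noteq> 0\<close>] l' by (metis dvd_triv_right)
  moreover have "y = 0 \<or> degree y < degree l'"
    unfolding y_def using nz(1) by (rule degree_mod_less)
  ultimately have y: "y = 0 \<or> degree y + 1 \<le> degree l" by auto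
  have "degree (r * y) \<le> m + degree l"
    using y r m degree_mult_le[of r y] by (cases "y = 0") auto
  then have "degree (l * x) \<le> m + degree l"
    using degree_diff_le[OF q] eq by (metis add_diff_cancel_right')
  then have "degree x \<le> m"
    using \<open>l \<noteq> 0\<close> by (cases "x = 0") (auto simp: degree_mult_eq)
  moreover have "degree y \<le> m" using y m by auto
  ultimately show thesis using eq that by blast
qed

text \<open>A common divisor of \<open>p\<close> and the variable divides the nonzero constant term of \<open>p\<close>.\<close>
lemma coprime_monom_1:
  fixes p :: "'a::field_gcd poly"
  assumes "coeff p 0 \<noteq> 0"
  shows "coprime p (monom 1 k)"
proof -
  have "coprime p [:0, 1:]"
  proof (rule coprimeI)
    fix d assume d: "d dvd p" "d dvd [:0, 1:]"
    obtain a p' where p: "p = pCons a p'" by (cases p)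
    have "p = [:a:] + [:0, 1:] * p'" by (simp add: p)
    with d have "d dvd [:a:]" by (metis dvd_add_left_iff dvd_mult2)
    moreover have "is_unit [:a:]" using assms by (simp add: p is_unit_const_poly_iff dvd_field_iff)
    ultimately show "is_unit d" by (rule dvd_unit_imp_unit)
  qed
  then show ?thesis
    by (simp add: monom_altdef coprime_power_right_iff)
qed

lemma order_gcd:
  fixes p q :: "'a::field_gcd poly"
  assumes "p \<noteq> 0" "q \<noteq> 0"
  shows "order a (gcd p q) = min (order a p) (order a q)"
proof -
  have "gcd p q \<noteq> 0" using assms by simp
  then have "k \<le> order a (gcd p q) \<longleftrightarrow> k \<le> min (order a p) (order a q)" for k
    using order_divides[of a k p] order_divides[of a k q] order_divides[of a k "gcd p q"] assms
    by (simp only: gcd_greatest_iff min.bounded_iff simp_thms)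
  then show ?thesis by (meson order_antisym order_refl)
qed

section \<open>The equations as one polynomial identity\<close>

text \<open>The recursion \<open>M\<^bsub>s+1\<^esub> + M\<^sub>s = - S\<^bsub>s+1\<^esub>\<close>, started at \<open>M\<^sub>0 = - S\<^sub>0\<close>, solved by alternating partial sums.\<close>
lemma one_plus_mult_eq_minus_iff:
  fixes M S :: "'a::comm_ring_1 poly"
  shows "[:1, 1:] * M = - S \<longleftrightarrow>
    (\<forall>s. coeff M s = (-1) ^ (s + 1) * (\<Sum>k=0..s. (-1) ^ k * coeff S k))" (is "?L \<longleftrightarrow> ?R")
proof
  assume L: ?L
  have c: "coeff M s + coeff (pCons 0 M) s = - coeff S s" for s
    using arg_cong[OF L, of "\<lambda>p. coeff p s"] by simp
  have "coeff M s = (-1) ^ (s + 1) * (\<Sum>k=0..s. (-1) ^ k * coeff S k)" for s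
  proof (induction s)
    case (Suc s)
    have "coeff M (Suc s) = - coeff S (Suc s) - coeff M s"
      using c[of "Suc s"] by (simp add: eq_diff_eq)
    then show ?case by (simp add: Suc algebra_simps flip: power_add)
  qed (use c[of 0] in simp)
  then show ?R by blast
next
  assume R: ?R
  show ?L
  proof (rule poly_eqI)
    show "coeff ([:1, 1:] * M) s = coeff (- S) s" for s
    proof (cases s)
      case 0
      then show ?thesis using R[rule_format, of 0] by simp
    next
      case (Suc j)
      then show ?thesis
        using R[rule_format, of s] R[rule_format, of j] by (simp add: algebra_simps flip: power_add)
    qed
  qed
qed

lemma sumC_eq_coeff:
  "sumC n c C s = coeff (scaled_poly 4 c * scaled_poly (n - 1) (\<lambda>i. C (i + 1) - C i)) s"
  unfolding mult.commute[of "scaled_poly 4 c"] sumC_def coeff_mult_scaled_poly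
  by (intro sum.cong) auto

lemma sumLR_eq_coeff:
  "sumLR n l r C L R s =
     coeff (scaled_poly 2 l * scaled_poly n (\<lambda>i. C i - L i) +
            scaled_poly 2 r * scaled_poly n (\<lambda>i. R i - C i)) s"
  unfolding coeff_add mult.commute[of "scaled_poly 2 _"] coeff_mult_scaled_poly sumLR_def
  by (simp add: algebra_simps split_def flip: sum.distrib)

lemma degree_sumC_poly_le:
  assumes "n \<ge> 1"
  shows "degree (scaled_poly 4 c * scaled_poly (n - 1) D) \<le> n + 3"
  using degree_mult_le[of "scaled_poly 4 c" "scaled_poly (n - 1) D"] assms
    degree_scaled_poly_le[of 4 c] degree_scaled_poly_le[of "n - 1" D] by linarith

lemma degree_sumLR_poly_le:
  "degree (scaled_poly 2 l * scaled_poly n X + scaled_poly 2 r * scaled_poly n Y) \<le> n + 2"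
proof -
  have "degree (scaled_poly 2 p * scaled_poly n q) \<le> n + 2" for p q
    using degree_mult_le[of "scaled_poly 2 p" "scaled_poly n q"]
      degree_scaled_poly_le[of 2 p] degree_scaled_poly_le[of n q] by linarith
  then show ?thesis by (intro degree_add_le)
qed

lemma sumC_equation_iff_root:
  assumes "n \<ge> 1"
  shows "sumC_equation n c C \<longleftrightarrow>
    poly (scaled_poly 4 c * scaled_poly (n - 1) (\<lambda>i. C (i + 1) - C i)) (-1) = 0"
  unfolding sumC_equation_def sumC_eq_coeff poly_eq_sum_le[OF degree_sumC_poly_le[OF assms]]
  by (simp add: atMost_atLeast0 mult.commute)

text \<open>Eq(\<open>s\<close>) for \<open>s \<le> n + 2\<close> is coefficient comparison in the range where the sumLR
  polynomial can be nonzero; the sumC-equation makes the alternating partial sums vanish beyond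
  that range, which supplies all remaining coefficients.\<close>
lemma G1_system_iff:
  assumes "n \<ge> 1"
  shows "((\<forall>s\<le>n + 2. Eq_s n l r c C L R s) \<and> sumC_equation n c C) \<longleftrightarrow>
    [:1, 1:] * (scaled_poly 2 l * scaled_poly n (\<lambda>i. C i - L i) +
                scaled_poly 2 r * scaled_poly n (\<lambda>i. R i - C i)) =
      - (scaled_poly 4 c * scaled_poly (n - 1) (\<lambda>i. C (i + 1) - C i))"
    (is "_ \<longleftrightarrow> [:1, 1:] * ?M = - ?S")
proof
  assume *: "(\<forall>s\<le>n + 2. Eq_s n l r c C L R s) \<and> sumC_equation n c C"
  have "coeff ?M s = (-1) ^ (s + 1) * (\<Sum>k=0..s. (-1) ^ k * coeff ?S k)" for s
  proof (cases "s \<le> n + 2")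
    case True
    then show ?thesis using * by (simp add: Eq_s_def sumLR_eq_coeff sumC_eq_coeff)
  next
    case False
    have "(\<Sum>k=0..s. (-1) ^ k * coeff ?S k) = (\<Sum>k=0..n + 3. (-1) ^ k * coeff ?S k)"
    proof (rule sum.mono_neutral_right)
      show "\<forall>k\<in>{0..s} - {0..n + 3}. (-1) ^ k * coeff ?S k = 0"
        using le_less_trans[OF degree_sumC_poly_le[OF assms]] by (simp add: coeff_eq_0)
    qed (use False in auto)
    moreover have "coeff ?M s = 0"
      using le_less_trans[OF degree_sumLR_poly_le, of n s] False by (intro coeff_eq_0) simp
    ultimately show ?thesis
      using * by (simp add: sumC_equation_def sumC_eq_coeff)
  qed
  then show "[:1, 1:] * ?M = - ?S" unfolding one_plus_mult_eq_minus_iff by blast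
next
  assume *: "[:1, 1:] * ?M = - ?S"
  have "poly ?S (-1) = 0"
    using arg_cong[OF *, of "\<lambda>p. poly p (-1)"] by simp
  then have "sumC_equation n c C" by (simp only: sumC_equation_iff_root[OF assms])
  with * show "(\<forall>s\<le>n + 2. Eq_s n l r c C L R s) \<and> sumC_equation n c C"
    unfolding one_plus_mult_eq_minus_iff by (simp add: Eq_s_def sumLR_eq_coeff sumC_eq_coeff)
qed

text \<open>Eq(\<open>s\<close>) only involves the side coefficients with indices from \<open>s - 2\<close> to \<open>s\<close>, which are all
  outside the middle range for these \<open>s\<close>.\<close>
lemma Eq_s_outer_cong:
  assumes "\<forall>j \<in> {0..n} - {2..n' - 2}. L' j = L j \<and> R' j = R j"
    and "s \<le> 1 \<or> s \<ge> n' + 1"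
  shows "Eq_s n l r c C L' R' s \<longleftrightarrow> Eq_s n l r c C L R s"
proof -
  have "sumLR n l r C L' R' s = sumLR n l r C L R s"
    unfolding sumLR_def
  proof (intro sum.cong refl, clarify)
    fix i j :: nat
    assume ij: "i \<in> {0..n}" "j \<in> {0..2}" "s = i + j"
    then have "i \<in> {0..n} - {2..n' - 2}" using assms(2) by auto
    with assms(1) have "L' i = L i" "R' i = R i" by blast+
    then show "real (n choose i) * real (2 choose j) * (l j * (C i - L' i) + r j * (R' i - C i)) =
        real (n choose i) * real (2 choose j) * (l j * (C i - L i) + r j * (R i - C i))"
      by simp
  qed
  then show ?thesis by (simp add: Eq_s_def)
qed

section \<open>Consistency of the Middle system\<close>

text \<open>Combined with the prescribed equations, the Middle system is the full polynomial identity,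
  so consistency asks for \<open>- c D / (1 + t)\<close> to be a combination of \<open>l\<close> and \<open>r\<close> with bounded
  coefficients whose outer parts are given.\<close>
lemma middle_system_consistent_iff_dvd:
  assumes n: "n \<ge> 4" and l0: "l 0 \<noteq> 0" and l2: "l 2 \<noteq> 0"
    and outer: "\<And>s. s \<le> n + 2 \<Longrightarrow> s \<le> 1 \<or> s \<ge> nprime n + 1 \<Longrightarrow> Eq_s n l r c C L R s"
  shows "middle_system_consistent n l r c C L R \<longleftrightarrow>
    [:1, 1:] * gcd (scaled_poly 2 l) (scaled_poly 2 r) dvd
      scaled_poly 4 c * scaled_poly (n - 1) (\<lambda>i. C (i + 1) - C i)"
    (is "_ \<longleftrightarrow> _ * gcd ?l ?r dvd ?S")
proof
  assume "middle_system_consistent n l r c C L R"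
  then obtain L' R' where same: "\<forall>j \<in> {0..n} - {2..nprime n - 2}. L' j = L j \<and> R' j = R j"
    and mid: "\<forall>s \<in> {2..nprime n}. Eq_s n l r c C L' R' s" and "sumC_equation n c C"
    unfolding middle_system_consistent_def by blast
  have "Eq_s n l r c C L' R' s" if "s \<le> n + 2" for s
  proof (cases "s \<in> {2..nprime n}")
    case False
    then have s: "s \<le> 1 \<or> s \<ge> nprime n + 1" by auto
    then show ?thesis using Eq_s_outer_cong[OF same s] outer[OF that s] by blast
  qed (use mid in blast)
  with \<open>sumC_equation n c C\<close>
  have "(\<forall>s\<le>n + 2. Eq_s n l r c C L' R' s) \<and> sumC_equation n c C"
    by blast
  then have eq: "- ?S = [:1, 1:] *
      (?l * scaled_poly n (\<lambda>i. C i - L' i) + ?r * scaled_poly n (\<lambda>i. R' i - C i))"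
    using n by (subst (asm) G1_system_iff) (simp_all only:)
  have "[:1, 1:] * gcd ?l ?r dvd - ?S"
    unfolding eq by (intro mult_dvd_mono dvd_add dvd_mult2 dvd_refl gcd_dvd1 gcd_dvd2)
  then show "[:1, 1:] * gcd ?l ?r dvd ?S"
    unfolding dvd_minus_iff .
next
  assume "[:1, 1:] * gcd ?l ?r dvd ?S"
  then obtain K where K: "- ?S = [:1, 1:] * (gcd ?l ?r * K)"
    unfolding dvd_minus_iff[of _ ?S, symmetric] by (auto simp only: dvd_def mult.assoc)
  \<comment> \<open>The middle indices run from \<open>2\<close> to \<open>m + 2\<close>.\<close>
  define m where "m = nprime n - 4"
  have m: "nprime n = m + 4" "m \<ge> 1" "m + 2 \<le> n"
    using n by (auto simp: m_def nprime_def split: if_splits)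
  let ?X = "scaled_poly n (\<lambda>i. C i - L i)" and ?Y = "scaled_poly n (\<lambda>i. R i - C i)"
  \<comment> \<open>The right-hand side still to be produced by changing the middle coefficients.\<close>
  define M where "M = gcd ?l ?r * K - (?l * ?X + ?r * ?Y)"
  have coeffK: "coeff (gcd ?l ?r * K) s = (-1) ^ (s + 1) * (\<Sum>k=0..s. (-1) ^ k * sumC n c C k)" for s
    using K[symmetric] unfolding one_plus_mult_eq_minus_iff sumC_eq_coeff by blast
  have M0: "coeff M s = 0" if "s \<le> 1 \<or> s \<ge> m + 5" for s
  proof (cases "s \<le> n + 2")
    case True
    \<comment> \<open>This is where the prescribed equations enter.\<close>
    have "Eq_s n l r c C L R s" using True that m(1) by (intro outer) auto
    then show ?thesis
      unfolding M_def coeff_diff coeffK Eq_s_def sumLR_eq_coeff by simp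
  next
    case False
    have "degree ([:1, 1:] * (gcd ?l ?r * K)) \<le> n + 3"
      using degree_sumC_poly_le[of n c] n unfolding K[symmetric] degree_minus by simp
    then have "degree (gcd ?l ?r * K) \<le> n + 2"
      using degree_mult_eq[of "[:1, 1:]" "gcd ?l ?r * K"] by (cases "gcd ?l ?r * K = 0") auto
    then have "degree M \<le> n + 2"
      unfolding M_def using degree_sumLR_poly_le by (intro degree_diff_le)
    with False show ?thesis by (intro coeff_eq_0) simp
  qed
  define q where "q = poly_shift 2 M"
  have M_eq: "M = monom 1 2 * q"
  proof (rule poly_eqI)
    show "coeff M s = coeff (monom 1 2 * q) s" for s
    proof (cases "s \<le> 1")
      case False
      then have "s - 2 + 2 = s" by simp
      with False show ?thesis by (simp only: q_def coeff_monom_mult coeff_poly_shift) simp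
    qed (simp add: M0 coeff_monom_mult)
  qed
  have deg_l: "degree ?l = 2"
    using degree_scaled_poly_le[of 2 l] le_degree[of ?l 2] l2 by simp
  have deg_q: "degree q \<le> m + degree ?l"
    unfolding deg_l by (rule degree_le) (simp add: q_def coeff_poly_shift M0)
  have gcd_q: "gcd ?l ?r dvd q"
  proof -
    have "coeff (gcd ?l ?r) 0 \<noteq> 0"
    proof
      assume "coeff (gcd ?l ?r) 0 = 0"
      moreover obtain k where "?l = gcd ?l ?r * k"
        using gcd_dvd1 by (rule dvdE)
      ultimately have "coeff ?l 0 = 0"
        by (metis coeff_mult_0 mult_zero_left)
      with l0 show False by simp
    qed
    then have "coprime (gcd ?l ?r) (monom 1 2)" by (rule coprime_monom_1)
    moreover have "gcd ?l ?r dvd q * monom 1 2"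
      unfolding mult.commute[of q] M_eq[symmetric] M_def
      by (intro dvd_diff dvd_add dvd_triv_left) (intro dvd_mult2 gcd_dvd1 gcd_dvd2)+
    ultimately show ?thesis by (simp only: coprime_dvd_mult_left_iff)
  qed
  have "?l \<noteq> 0" "degree ?r \<le> degree ?l" "degree ?l \<le> m + 1"
    using deg_l degree_scaled_poly_le[of 2 r] m(2) by auto
  then obtain x y where deg: "degree x \<le> m" "degree y \<le> m" and xy: "?l * x + ?r * y = q"
    using deg_q gcd_q by (rule bounded_bezout)
  define L' where "L' i = L i - coeff (monom 1 2 * x) i / real (n choose i)" for i
  define R' where "R' i = R i + coeff (monom 1 2 * y) i / real (n choose i)" for i
  have deg2: "degree (monom 1 2 * p) \<le> n" if "degree p \<le> m" for p :: "real poly"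
    using that m(3) degree_mult_le[of "monom 1 2" p] by (simp add: degree_monom_eq)
  have X': "scaled_poly n (\<lambda>i. C i - L' i) = ?X + monom 1 2 * x"
    unfolding scaled_poly_add[OF deg2[OF deg(1)], symmetric] L'_def
    by (simp only: diff_diff_eq2 diff_add_eq)
  have Y': "scaled_poly n (\<lambda>i. R' i - C i) = ?Y + monom 1 2 * y"
    unfolding scaled_poly_add[OF deg2[OF deg(2)], symmetric] R'_def
    by (simp only: diff_add_eq)
  have "?l * (?X + monom 1 2 * x) + ?r * (?Y + monom 1 2 * y)
      = (?l * ?X + ?r * ?Y) + monom 1 2 * (?l * x + ?r * y)"
    by (simp only: distrib_left mult.left_commute add_ac)
  also have "\<dots> = gcd ?l ?r * K"
    unfolding xy M_eq[symmetric] M_def by simp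
  finally have "(\<forall>s\<le>n + 2. Eq_s n l r c C L' R' s) \<and> sumC_equation n c C"
    using n by (subst G1_system_iff) (simp_all only: X' Y' K)
  moreover have "L' j = L j \<and> R' j = R j" if "j \<in> {0..n} - {2..nprime n - 2}" for j
  proof -
    have "j < 2 \<or> j - 2 > m" using that m(1) by auto
    then have "coeff (monom 1 2 * p) j = 0" if "degree p \<le> m" for p :: "real poly"
      using that by (auto simp: coeff_monom_mult coeff_eq_0)
    then show ?thesis using deg by (simp add: L'_def R'_def)
  qed
  moreover have "nprime n \<le> n + 2" by (simp add: nprime_def)
  ultimately show "middle_system_consistent n l r c C L R"
    unfolding middle_system_consistent_def by (intro exI[of _ L'] exI[of _ R']) auto
qed

section \<open>The degree condition\<close>

text \<open>By \<open>degree_bezier_poly\<close> the two degrees are \<open>4\<close> and \<open>2\<close> minus the orders of \<open>c\<close> and of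
  \<open>gcd l r\<close> at \<open>-1\<close>, so their difference is \<open>2\<close> minus the order of the cofactor \<open>w\<close>.  For
  \<open>w = 0\<close> the zero polynomial \<open>c\<close> has degree \<open>0\<close>, and the difference is not positive.\<close>
lemma degree_difference_eq_2_iff:
  assumes l: "scaled_poly 2 l \<noteq> 0" and r: "scaled_poly 2 r \<noteq> 0"
    and w: "scaled_poly 4 c = gcd (scaled_poly 2 l) (scaled_poly 2 r) * w"
  shows "int (degree (bezier_poly 4 c))
        - int (max (degree (bezier_poly 2 l)) (degree (bezier_poly 2 r))) = 2 \<longleftrightarrow>
      poly w (-1) \<noteq> 0"
proof (cases "w = 0")
  case True
  have "bezier_poly 4 c = 0"
    using True w by (simp add: bezier_poly_eq_homogenization homogenization_def)
  then show ?thesis using True by simp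
next
  case False
  have g: "gcd (scaled_poly 2 l) (scaled_poly 2 r) \<noteq> 0" using l by simp
  then have c: "scaled_poly 4 c \<noteq> 0" using False w by simp
  have "order (-1) (scaled_poly 4 c) =
      min (order (-1) (scaled_poly 2 l)) (order (-1) (scaled_poly 2 r)) + order (-1) w"
    using c unfolding w by (simp add: order_mult order_gcd[OF l r])
  then have "int (degree (bezier_poly 4 c))
        - int (max (degree (bezier_poly 2 l)) (degree (bezier_poly 2 r))) = 2 - int (order (-1) w)"
    using degree_bezier_poly[OF l] degree_bezier_poly[OF r] degree_bezier_poly[OF c] by linarith
  then show ?thesis using False by (simp add: order_root)
qed

section \<open>The weights of the edge\<close>

lemma scaled_poly_weight_l:
  "scaled_poly 2 (weight_l_coeff b e) =
     smult (e $ 2) (scaled_poly 2 (\<lambda>i. b i $ 1)) - smult (e $ 1) (scaled_poly 2 (\<lambda>i. b i $ 2))"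
  by (rule poly_eqI) (simp add: weight_l_coeff_def planar_cross_def algebra_simps)

lemma scaled_poly_weight_r:
  "scaled_poly 2 (weight_r_coeff a e) =
     smult (e $ 1) (scaled_poly 2 (\<lambda>i. a i $ 2)) - smult (e $ 2) (scaled_poly 2 (\<lambda>i. a i $ 1))"
  by (rule poly_eqI) (simp add: weight_r_coeff_def planar_cross_def algebra_simps)

lemma scaled_poly_weight_c:
  "scaled_poly 4 (weight_c_coeff a b) =
     scaled_poly 2 (\<lambda>i. a i $ 1) * scaled_poly 2 (\<lambda>i. b i $ 2) -
     scaled_poly 2 (\<lambda>i. a i $ 2) * scaled_poly 2 (\<lambda>i. b i $ 1)"
proof (rule poly_eqI)
  fix k
  have *: "4 choose k = 0 \<Longrightarrow> {(i, j). i \<in> {0..2} \<and> j \<in> {0..2} \<and> i + j = k} = {}"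
    by auto
  show "coeff (scaled_poly 4 (weight_c_coeff a b)) k = coeff (scaled_poly 2 (\<lambda>i. a i $ 1) *
      scaled_poly 2 (\<lambda>i. b i $ 2) - scaled_poly 2 (\<lambda>i. a i $ 2) * scaled_poly 2 (\<lambda>i. b i $ 1)) k"
  proof (cases "4 choose k = 0")
    case True
    show ?thesis
      unfolding coeff_diff coeff_mult_scaled_poly coeff_scaled_poly *[OF True] True by simp
  next
    case False
    then show ?thesis
      unfolding coeff_diff coeff_mult_scaled_poly coeff_scaled_poly weight_c_coeff_def
      by (simp add: planar_cross_def split_def right_diff_distrib flip: sum_subtractf)
  qed
qed

text \<open>Solving the formulas of \<open>l\<close> and \<open>r\<close> for one component of \<open>a\<close> and \<open>b\<close> and substituting into
  the cross product gives \<open>e\<^sub>k c = - a\<^sub>k l - b\<^sub>k r\<close> for both coordinates \<open>k\<close>.\<close>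
lemma gcd_weights_dvd_weight_c:
  assumes "e \<noteq> 0"
  shows "gcd (scaled_poly 2 (weight_l_coeff b e)) (scaled_poly 2 (weight_r_coeff a e))
    dvd scaled_poly 4 (weight_c_coeff a b)" (is "gcd ?l ?r dvd ?c")
proof -
  let ?a = "\<lambda>k. scaled_poly 2 (\<lambda>i. a i $ k)" and ?b = "\<lambda>k. scaled_poly 2 (\<lambda>i. b i $ k)"
  have eq: "smult (e $ k) ?c = - (?a k * ?l) - ?b k * ?r" if "k = 1 \<or> k = 2" for k
    using that by (auto simp: scaled_poly_weight_l scaled_poly_weight_r scaled_poly_weight_c
        algebra_simps smult_diff_right)
  obtain k :: 2 where k: "k = 1 \<or> k = 2" "e $ k \<noteq> 0"
    using assms by (auto simp: vec_eq_iff forall_2)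
  have "gcd ?l ?r dvd smult (e $ k) ?c"
    unfolding eq[OF k(1)] by (intro dvd_diff) (auto intro: dvd_mult)
  with k(2) show ?thesis by (simp add: dvd_smult_iff)
qed

text \<open>Regularity of the right patch at the boundary vertex thereby excludes \<open>l\<^sub>2 = 0\<close>.\<close>
lemma right_patch_jacobian_corner:
  "jacobian (bicubic_patch \<gamma> \<rho> \<rho>' \<gamma>' T S) 0 1 =
     weight_l_coeff (right_deriv_coeff \<gamma> \<gamma>' \<rho> \<rho>' T) (\<gamma>' - \<gamma>) 2"
proof -
  have "((\<lambda>t. bicubic_patch \<gamma> \<rho> \<rho>' \<gamma>' T S 0 t) has_vector_derivative \<gamma>' - \<gamma>) (at 1)"
    unfolding patch_common_edge by (auto intro!: derivative_eq_intros)
  moreover have "((\<lambda>s. bicubic_patch \<gamma> \<rho> \<rho>' \<gamma>' T S s 1) has_vector_derivative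
      right_deriv_coeff \<gamma> \<gamma>' \<rho> \<rho>' T 2) (at 0)"
    using right_patch_u_derivative[of \<gamma> \<rho> \<rho>' \<gamma>' T S 1]
    by (simp add: Bernstein_def numeral_eq_Suc)
  ultimately show ?thesis
    by (simp add: jacobian_def weight_l_coeff_def vector_derivative_at)
qed

theorem theorem8:
  fixes n :: nat
    and \<gamma> \<gamma>' \<rho> \<rho>' lam lam' T\<^sub>\<rho> S\<^sub>\<rho> T\<^sub>l S\<^sub>l :: "real ^ 2"
    and a b :: "nat \<Rightarrow> real ^ 2"
    and l r c C L R :: "nat \<Rightarrow> real"
  assumes n: "n \<ge> 4"
    and right_convex: "strictly_convex_quad \<gamma> \<rho> \<rho>' \<gamma>'"
    and right_side: "right_of \<gamma> \<gamma>' \<rho>" "right_of \<gamma> \<gamma>' \<rho>'"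
    and left_convex: "strictly_convex_quad \<gamma> lam lam' \<gamma>'"
    and left_side: "left_of \<gamma> \<gamma>' lam" "left_of \<gamma> \<gamma>' lam'"
    and right_regular: "regular_bicubic_patch \<gamma> \<rho> \<rho>' \<gamma>' T\<^sub>\<rho> S\<^sub>\<rho>"
    and left_regular: "regular_bicubic_patch lam \<gamma> \<gamma>' lam' S\<^sub>l T\<^sub>l"
    and G1_nondegenerate: "\<gamma>' - T\<^sub>l \<noteq> 0" "T\<^sub>\<rho> - \<gamma>' \<noteq> 0"
    and G1_direction: "\<exists>t>0. T\<^sub>\<rho> - \<gamma>' = t *\<^sub>R (\<gamma>' - T\<^sub>l)"
    and a: "a = left_deriv_coeff \<gamma> \<gamma>' lam lam' T\<^sub>l"
    and b: "b = right_deriv_coeff \<gamma> \<gamma>' \<rho> \<rho>' T\<^sub>\<rho>"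
    and l: "l = weight_l_coeff b (\<gamma>' - \<gamma>)"
    and r: "r = weight_r_coeff a (\<gamma>' - \<gamma>)"
    and c: "c = weight_c_coeff a b"
    and Eq_0: "Eq_s n l r c C L R 0"
    and Eq_1: "Eq_s n l r c C L R 1"
    and Eq_n'1: "Eq_s n l r c C L R (nprime n + 1)"
    and Eq_n'2: "n \<ge> 5 \<Longrightarrow> Eq_s n l r c C L R (nprime n + 2)"
  shows "(degree_condition n l r c C \<longrightarrow> sumC_equation n c C) \<and>
         (degree_condition n l r c C \<longleftrightarrow> middle_system_consistent n l r c C L R)"
proof -
  let ?l = "scaled_poly 2 l" and ?r = "scaled_poly 2 r" and ?c = "scaled_poly 4 c"
  let ?D = "scaled_poly (n - 1) (\<lambda>i. C (i + 1) - C i)"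
  have l0: "l 0 \<noteq> 0"
    using right_side(1) by (auto simp: l b weight_l_coeff_def right_deriv_coeff_def right_of_def
        planar_cross_def algebra_simps)
  have r0: "r 0 \<noteq> 0"
    using left_side(1) by (auto simp: r a weight_r_coeff_def left_deriv_coeff_def left_of_def
        planar_cross_def algebra_simps)
  have l2: "l 2 \<noteq> 0"
    using right_regular unfolding regular_bicubic_patch_def l b
    by (simp flip: right_patch_jacobian_corner[of \<gamma> \<rho> \<rho>' \<gamma>' T\<^sub>\<rho> S\<^sub>\<rho>])
  have "\<gamma>' - \<gamma> \<noteq> 0"
    using right_side(1) by (auto simp: right_of_def planar_cross_def)
  then obtain w where w: "?c = gcd ?l ?r * w"
    using gcd_weights_dvd_weight_c unfolding l r c by blast
  have nz: "?l \<noteq> 0" "?r \<noteq> 0"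
    using l0 r0 by (auto simp: poly_eq_iff intro!: exI[of _ 0])
  have cond: "degree_condition n l r c C \<longleftrightarrow> poly (w * ?D) (-1) = 0"
    unfolding degree_condition_def degree_difference_eq_2_iff[OF nz w]
    using n by (auto simp: C_equation_iff_root)
  have "degree_condition n l r c C \<longrightarrow> sumC_equation n c C"
    unfolding cond using n by (simp add: sumC_equation_iff_root w)
  moreover have "middle_system_consistent n l r c C L R \<longleftrightarrow> [:1, 1:] * gcd ?l ?r dvd ?c * ?D"
  proof (rule middle_system_consistent_iff_dvd[OF n l0 l2])
    fix s assume "s \<le> n + 2" "s \<le> 1 \<or> s \<ge> nprime n + 1"
    then consider "s = 0" | "s = 1" | "s = nprime n + 1" | "n \<ge> 5" "s = nprime n + 2"
      using n by (fastforce simp: nprime_def split: if_splits)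
    then show "Eq_s n l r c C L R s"
      using Eq_0 Eq_1 Eq_n'1 Eq_n'2 by cases auto
  qed
  moreover have "[:1, 1:] * gcd ?l ?r dvd ?c * ?D \<longleftrightarrow> poly (w * ?D) (-1) = 0"
  proof -
    have "[:1, 1:] * gcd ?l ?r dvd ?c * ?D \<longleftrightarrow> gcd ?l ?r * [:1, 1:] dvd gcd ?l ?r * (w * ?D)"
      by (simp only: w mult.commute[of "[:1, 1:]"] mult.assoc)
    also have "\<dots> \<longleftrightarrow> [:1, 1:] dvd w * ?D"
      using nz(1) by (subst dvd_mult_cancel_left) simp
    finally show ?thesis by (simp only: poly_eq_0_iff_dvd minus_minus)
  qed
  ultimately show ?thesis using cond by blast
qed

end
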